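(* Let $K$ be a field and let $L$ be a finite modular lattice. Let $I_L \subset K[L]$ be the ideal generated by all basic binomials $ab-(a\wedge b)(a\vee b)$, $a,b\in L$. Then the following conditions are equivalent: (i) $L$ is a distributive lattice; (ii) $I_L$ has a squarefree Gröbner basis with respect to any rank reverse lexicographic order on $K[L]$.
   Context: For a finite lattice $L$ and a field $K$, $K[L]$ denotes the polynomial ring over $K$ in $|L|$ variables, the variables being the elements of $L$. A binomial of the form $ab-(a\wedge b)(a\vee b)$ with $a,b\in L$ (a polynomial in $K[L]$, where products are products of variables) is called a basic binomial, and $I_L$ is the ideal of $K[L]$ generated by all basic binomials. A lattice $L$ is modular if $x\le b$ implies $x\vee(a\wedge b)=(x\vee a)\wedge b$ for all $x,a,b\in L$; it is distributive if $x\wedge(y\vee z)=(x\wedge y)\vee(x\wedge z)$ and $x\vee(y\wedge z)=(x\vee y)\wedge(x\vee z)$ for all $x,y,z\in L$. A finite lattice is pure if all maximal chains between its minimum $\hat 0$ and its maximum $\hat 1$ have the same length; every finite modular lattice is pure. For an element $a$ of a finite pure lattice, $\mathrm{rank}(a)$ is the largest integer $r$ for which there is a chain $\hat 0=a_0<a_1<\cdots<a_r=a$ in $L$. A rank reverse lexicographic order on $K[L]$ is a (degree) reverse lexicographic monomial order induced by a total order of the variables such that the variable $a$ is larger than the variable $b$ whenever $\mathrm{rank}(a)>\mathrm{rank}(b)$ (elements of equal rank may be ordered arbitrarily). "Any" means: for every such order. For a monomial order $<$, $\mathrm{in}_<(I_L)$ denotes the initial ideal of $I_L$. To say that $I_L$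 has a squarefree Gröbner basis with respect to $<$ means that it has a Gröbner basis whose initial monomials are squarefree, i.e. that $\mathrm{in}_<(I_L)$ is generated by squarefree monomials. *)

theory Defs
  imports Complex_Main "HOL-Library.Poly_Mapping"
begin

section \<open>Finite lattices\<close>

text \<open>A finite lattice \<open>L\<close> is a type \<open>'l\<close> of sort \<open>{finite, lattice}\<close>; types are
  nonempty, so \<open>L\<close> has a minimum, written \<^term>\<open>Inf_fin UNIV\<close>. Modularity and
  distributivity are predicates because the theorem speaks of lattices that may fail to be
  distributive, which the class \<^class>\<open>distrib_lattice\<close> cannot express.\<close>

definition modular_lattice :: "'l::lattice itself \<Rightarrow> bool" where
  "modular_lattice _ \<longleftrightarrow>
     (\<forall>x a b :: 'l. x \<le> b \<longrightarrow> sup x (inf a b) = inf (sup x a) b)"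

definition distributive_lattice :: "'l::lattice itself \<Rightarrow> bool" where
  "distributive_lattice _ \<longleftrightarrow>
     (\<forall>x y z :: 'l. inf x (sup y z) = sup (inf x y) (inf x z) \<and>
                    sup x (inf y z) = inf (sup x y) (sup x z))"

definition lattice_rank :: "'l::{finite,lattice} \<Rightarrow> nat" where
  "lattice_rank a = Max {r. \<exists>c :: nat \<Rightarrow> 'l. c 0 = Inf_fin UNIV \<and> c r = a \<and> (\<forall>i<r. c i < c (Suc i))}"


section \<open>Polynomials and ideals\<close>

text \<open>A monomial in the variables \<open>'v\<close> is its finitely supported exponent function, and a
  polynomial is a finitely supported function from monomials to coefficients; the
  multiplication of \<^type>\<open>poly_mapping\<close> is the convolution product.\<close>

type_synonym 'v monom = "'v \<Rightarrow>\<^sub>0 nat"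
type_synonym ('v, 'k) mpoly = "'v monom \<Rightarrow>\<^sub>0 'k"

definition monomial :: "'v monom \<Rightarrow> ('v, 'k::zero_neq_one) mpoly" where
  "monomial m = Poly_Mapping.single m 1"

definition var :: "'v \<Rightarrow> ('v, 'k::zero_neq_one) mpoly" where
  "var x = monomial (Poly_Mapping.single x 1)"

lemma module_times: "module ((*) :: 'a::comm_ring_1 \<Rightarrow> 'a \<Rightarrow> 'a)"
  by standard (simp_all add: algebra_simps)

definition ideal_generated_by :: "'a::comm_ring_1 set \<Rightarrow> 'a set" where
  "ideal_generated_by S = module.span (*) S"

definition basic_binomials :: "('l::lattice, 'k::comm_ring_1) mpoly set" where
  "basic_binomials = {var a * var b - var (inf a b) * var (sup a b) | a b. True}"

definition lattice_ideal :: "('l::lattice, 'k::comm_ring_1) mpoly set" where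
  "lattice_ideal = ideal_generated_by basic_binomials"


section \<open>Monomial orders and Groebner bases\<close>

text \<open>A monomial order is given by its strict part: \<open>ord m n\<close> means that \<open>m\<close> is smaller
  than \<open>n\<close>.\<close>

type_synonym 'v monom_order = "'v monom \<Rightarrow> 'v monom \<Rightarrow> bool"

definition total_degree :: "'v monom \<Rightarrow> nat" where
  "total_degree m = (\<Sum>x\<in>Poly_Mapping.keys m. Poly_Mapping.lookup m x)"

text \<open>\<open>(y, x) \<in> r\<close> means that the variable \<open>y\<close> is smaller than \<open>x\<close>. Among monomials of equal
  degree, the smaller one is the one with the larger exponent at the smallest variable at
  which the two differ.\<close>

definition degrevlex :: "'v rel \<Rightarrow> 'v monom_order" where
  "degrevlex r m n \<longleftrightarrow>
     total_degree m < total_degree n \<or>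
     (total_degree m = total_degree n \<and>
      (\<exists>x. Poly_Mapping.lookup n x < Poly_Mapping.lookup m x \<and>
           (\<forall>y. (y, x) \<in> r \<longrightarrow> Poly_Mapping.lookup m y = Poly_Mapping.lookup n y)))"

definition rank_revlex_order :: "('l::{finite,lattice}) monom_order \<Rightarrow> bool" where
  "rank_revlex_order ord \<longleftrightarrow>
     (\<exists>r :: 'l rel. strict_linear_order r \<and>
        (\<forall>a b. lattice_rank b < lattice_rank a \<longrightarrow> (b, a) \<in> r) \<and>
        ord = degrevlex r)"

definition initial_monomial :: "'v monom_order \<Rightarrow> ('v, 'k::zero) mpoly \<Rightarrow> 'v monom" where
  "initial_monomial ord f =
     (THE m. m \<in> Poly_Mapping.keys f \<and> (\<forall>n\<in>Poly_Mapping.keys f. n \<noteq> m \<longrightarrow> ord n m))"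

definition initial_ideal ::
    "'v monom_order \<Rightarrow> ('v, 'k::comm_ring_1) mpoly set \<Rightarrow> ('v, 'k) mpoly set" where
  "initial_ideal ord I = ideal_generated_by {monomial (initial_monomial ord f) | f. f \<in> I \<and> f \<noteq> 0}"

definition is_groebner_basis ::
    "'v monom_order \<Rightarrow> ('v, 'k::comm_ring_1) mpoly set \<Rightarrow> ('v, 'k) mpoly set \<Rightarrow> bool" where
  "is_groebner_basis ord I G \<longleftrightarrow>
     finite G \<and> G \<subseteq> I \<and> 0 \<notin> G \<and>
     ideal_generated_by {monomial (initial_monomial ord g) | g. g \<in> G} = initial_ideal ord I"

definition squarefree_monom :: "'v monom \<Rightarrow> bool" where
  "squarefree_monom m \<longleftrightarrow> (\<forall>x. Poly_Mapping.lookup m x \<le> 1)"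

definition has_squarefree_groebner_basis ::
    "'v monom_order \<Rightarrow> ('v, 'k::comm_ring_1) mpoly set \<Rightarrow> bool" where
  "has_squarefree_groebner_basis ord I \<longleftrightarrow>
     (\<exists>G. is_groebner_basis ord I G \<and> (\<forall>g\<in>G. squarefree_monom (initial_monomial ord g)))"

end

theory Submission
  imports Defs
begin

text \<open>The whole argument takes place among monomials. Since the generators of the ideal are
  differences of monomials, the ideal identifies two monomials exactly when one can be turned
  into the other by exchanges \<open>a b \<leftrightarrow> (a \<and> b) (a \<or> b)\<close>, and for every element of the ideal the
  coefficients in each exchange class (more generally, in each set of monomials closed under
  exchanges) sum to zero (\<open>coeff_sum_lattice_ideal\<close>). Hence an initial monomial is never the
  least monomial of a class, while every monomial that is not the least of its class is one.
  In a rank reverse lexicographic order, \<open>a \<and> b\<close> is the smallest of the four variables, so that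
  replacing incomparable \<open>a b\<close> by \<open>(a \<and> b) (a \<or> b)\<close> makes a monomial smaller; the least monomial
  of a class is therefore supported on a chain.

  If the lattice is distributive, the number of entries of a monomial above each join-prime
  element is invariant under exchanges, and by Birkhoff's representation these numbers
  determine a monomial supported on a chain (\<open>chain_monom_unique\<close>). So chain monomials are
  exactly the least monomials of the classes; the initial ideal is generated by the products
  \<open>a b\<close> of incomparable elements, which are squarefree.

  If the lattice is modular but \<open>x \<and> (y \<or> z) \<noteq> (x \<and> y) \<or> (x \<and> z)\<close>, then straightening \<open>x y z\<close>
  in two different ways gives \<open>l a h\<close> and \<open>l b h\<close> with \<open>a \<noteq> b\<close>, where \<open>l\<close> and \<open>h\<close> are the meet and
  the join of \<open>x\<close>, \<open>y\<close>, \<open>z\<close> (\<open>non_distributive_equivalent_triples\<close>). The least monomial of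
  their class has the form \<open>l c h\<close>, where \<open>c\<close> has the same rank as \<open>a\<close> and \<open>b\<close> because rank is
  a valuation. One of \<open>a\<close>, \<open>b\<close>, say \<open>d\<close>, is not above \<open>c\<close>, and
  \<open>l c\<^sup>2 h\<close> is equivalent to \<open>l d c h\<close>, hence to the smaller monomial \<open>l (c \<and> d) (c \<or> d) h\<close>. Thus
  \<open>l c\<^sup>2 h\<close> lies in the initial ideal, and if this ideal were generated by squarefree monomials,
  it would also contain \<open>l c h\<close>, which is impossible for the least monomial of a class.\<close>


section \<open>Ranks in modular lattices\<close>

definition covered_by :: "'l::lattice \<Rightarrow> 'l \<Rightarrow> bool" where
  "covered_by x y \<longleftrightarrow> x < y \<and> (\<forall>t. x \<le> t \<longrightarrow> t \<le> y \<longrightarrow> t = x \<or> t = y)"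

definition bottom_chain :: "(nat \<Rightarrow> 'l::{finite,lattice}) \<Rightarrow> nat \<Rightarrow> 'l \<Rightarrow> bool" where
  "bottom_chain c r a \<longleftrightarrow> c 0 = Inf_fin UNIV \<and> c r = a \<and> (\<forall>i<r. c i < c (Suc i))"

lemma Inf_fin_UNIV_le: "Inf_fin UNIV \<le> (x::'l::{finite,lattice})"
  by (simp add: Inf_fin.coboundedI)

lemma bottom_chain_less:
  assumes "bottom_chain c r a" "i < j" "j \<le> r"
  shows "c i < c j"
  using assms(2,3)
proof (induction j)
  case (Suc j)
  then have step: "c j < c (Suc j)"
    using assms(1) by (simp add: bottom_chain_def)
  show ?case
  proof (cases "i = j")
    case False
    then have "c i < c j" using Suc by simp
    then show ?thesis using step by (rule less_trans)
  qed (use step in simp)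
qed simp

lemma finite_bottom_chain_lengths:
  "finite {r. \<exists>c. bottom_chain c r (a::'l::{finite,lattice})}"
proof (rule finite_subset)
  show "{r. \<exists>c. bottom_chain c r a} \<subseteq> {..card (UNIV :: 'l set)}"
  proof
    fix r assume "r \<in> {r. \<exists>c. bottom_chain c r a}"
    then obtain c where c: "bottom_chain c r a" by blast
    have "inj_on c {..r}"
    proof (rule linorder_inj_onI')
      show "c i \<noteq> c j" if "i \<in> {..r}" "j \<in> {..r}" "i < j" for i j
        using bottom_chain_less[OF c, of i j] that by auto
    qed
    then have "card {..r} \<le> card (UNIV :: 'l set)"
      by (metis card_image card_mono finite subset_UNIV)
    then show "r \<in> {..card (UNIV :: 'l set)}" by simp
  qed
qed simp

lemma lattice_rank_eq_Max: "lattice_rank a = Max {r. \<exists>c. bottom_chain c r a}"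
  by (simp add: lattice_rank_def bottom_chain_def)

lemma bottom_chain_le_rank: "bottom_chain c r a \<Longrightarrow> r \<le> lattice_rank a"
  unfolding lattice_rank_eq_Max by (rule Max_ge[OF finite_bottom_chain_lengths]) blast

lemma bottom_chain_rank:
  obtains c where "bottom_chain c (lattice_rank (a::'l::{finite,lattice})) a"
proof -
  have "{r. \<exists>c. bottom_chain c r a} \<noteq> {}"
  proof (cases "a = Inf_fin UNIV")
    case True
    then have "bottom_chain (\<lambda>_. a) 0 a" by (simp add: bottom_chain_def)
    then show ?thesis by blast
  next
    case False
    then have "Inf_fin UNIV < a" using Inf_fin_UNIV_le[of a] by (simp add: less_le)
    then have "bottom_chain (\<lambda>i. if i = 0 then Inf_fin UNIV else a) 1 a"
      by (simp add: bottom_chain_def)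
    then show ?thesis by blast
  qed
  from Max_in[OF finite_bottom_chain_lengths this] show thesis
    using that by (auto simp: lattice_rank_eq_Max)
qed

text \<open>A longest chain ending in \<open>a\<close> can be prolonged by \<open>b\<close>.\<close>

lemma lattice_rank_less:
  assumes "a < (b::'l::{finite,lattice})"
  shows "lattice_rank a < lattice_rank b"
proof -
  obtain c where c: "bottom_chain c (lattice_rank a) a" by (rule bottom_chain_rank)
  have "bottom_chain (c(Suc (lattice_rank a) := b)) (Suc (lattice_rank a)) b"
    using c assms by (auto simp: bottom_chain_def less_Suc_eq)
  then show ?thesis using bottom_chain_le_rank by fastforce
qed

lemma eq_if_le_if_rank_eq:
  "a \<le> b \<Longrightarrow> lattice_rank a = lattice_rank b \<Longrightarrow> a = (b::'l::{finite,lattice})"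
  by (metis lattice_rank_less less_le nless_le)

lemma rank_predecessor:
  assumes "a < (b::'l::{finite,lattice})"
  obtains z where "z < b" "lattice_rank b = Suc (lattice_rank z)"
proof -
  obtain c where c: "bottom_chain c (lattice_rank b) b" by (rule bottom_chain_rank)
  obtain r where r: "lattice_rank b = Suc r"
    using lattice_rank_less[OF assms] by (cases "lattice_rank b") auto
  have less: "c r < b" and "bottom_chain c r (c r)"
    using c by (auto simp: bottom_chain_def r)
  then have "lattice_rank b = Suc (lattice_rank (c r))"
    using bottom_chain_le_rank lattice_rank_less[OF less] r by fastforce
  then show thesis using that less by blast
qed

lemma modular_latticeD:
  "modular_lattice TYPE('l::lattice) \<Longrightarrow> (x::'l) \<le> b \<Longrightarrow> sup x (inf a b) = inf (sup x a) b"
  by (simp add: modular_lattice_def)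

text \<open>In a modular lattice the maps \<open>t \<mapsto> x \<or> t\<close> and \<open>t \<mapsto> t \<and> z\<close> are inverse isomorphisms between
  the intervals \<open>[x \<and> z, z]\<close> and \<open>[x, x \<or> z]\<close>, so one of them has just two elements if and only
  if the other does.\<close>

lemma modular_covered_by_transpose:
  fixes x z :: "'l::lattice"
  assumes mod: "modular_lattice TYPE('l)"
  shows "covered_by (inf x z) z \<longleftrightarrow> covered_by x (sup x z)"
proof
  assume cov: "covered_by (inf x z) z"
  show "covered_by x (sup x z)"
    unfolding covered_by_def
  proof (intro conjI allI impI)
    show "x < sup x z"
      using cov unfolding covered_by_def by (metis inf.absorb2 le_iff_sup less_le sup_ge1 sup_ge2 order_refl)
    fix t assume t: "x \<le> t" "t \<le> sup x z"
    have "inf x z \<le> inf z t" using t(1) by (meson inf_greatest inf_le1 inf_le2 order_trans)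
    then have "inf z t = inf x z \<or> inf z t = z"
      using cov unfolding covered_by_def by (meson inf_le1)
    moreover have "sup x (inf z t) = t"
      using modular_latticeD[OF mod t(1), of z] t(2) by (simp add: inf.absorb2)
    ultimately show "t = x \<or> t = sup x z" by auto
  qed
next
  assume cov: "covered_by x (sup x z)"
  show "covered_by (inf x z) z"
    unfolding covered_by_def
  proof (intro conjI allI impI)
    show "inf x z < z"
      using cov unfolding covered_by_def by (metis inf.absorb_iff2 inf_le2 less_le sup.absorb1)
    fix t assume t: "inf x z \<le> t" "t \<le> z"
    have "sup t x \<le> sup x z" using t(2) by (simp add: le_supI2)
    then have "sup t x = x \<or> sup t x = sup x z"
      using cov unfolding covered_by_def by (meson sup_ge2)
    moreover have "inf (sup t x) z = t"
      using modular_latticeD[OF mod t(2), of x] t(1) by (simp add: sup.absorb1)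
    ultimately show "t = inf x z \<or> t = z" by (metis inf.absorb2 sup_ge2)
  qed
qed

text \<open>This is the Jordan-Dedekind chain condition. The element \<open>z\<close> below \<open>y\<close> on a longest chain
  is covered by \<open>y\<close> and has the rank that is claimed for \<open>x\<close>. If \<open>z \<noteq> x\<close>, then both cover
  \<open>x \<and> z\<close>, and induction gives them the same rank.\<close>

lemma rank_covered_by:
  fixes x y :: "'l::{finite,lattice}"
  assumes mod: "modular_lattice TYPE('l)" and "covered_by x y"
  shows "lattice_rank y = Suc (lattice_rank x)"
  using assms(2)
proof (induction "lattice_rank y" arbitrary: x y rule: less_induct)
  case less
  have "x < y" using less.prems by (simp add: covered_by_def)
  then obtain z where z: "z < y" "lattice_rank y = Suc (lattice_rank z)"
    by (rule rank_predecessor)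
  have covz: "covered_by z y"
    unfolding covered_by_def
  proof (intro conjI allI impI)
    fix t assume t: "z \<le> t" "t \<le> y"
    show "t = z \<or> t = y"
    proof (rule ccontr)
      assume "\<not> (t = z \<or> t = y)"
      then have "z < t" "t < y" using t by auto
      then show False using lattice_rank_less[of z t] lattice_rank_less[of t y] z by simp
    qed
  qed (rule z)
  show ?case
  proof (cases "x = z")
    case False
    have "\<not> z \<le> x" using False covz \<open>x < y\<close> unfolding covered_by_def by (metis less_le)
    have sup: "sup x z = y"
    proof -
      have "sup x z \<noteq> x" using \<open>\<not> z \<le> x\<close> by (metis sup_ge2)
      moreover have "sup x z \<le> y" using z \<open>x < y\<close> by (simp add: less_le)
      ultimately show ?thesis using less.prems unfolding covered_by_def by (meson sup_ge1)
    qed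
    have "covered_by (inf x z) z" "covered_by (inf z x) x"
      using less.prems covz sup modular_covered_by_transpose[OF mod] by (metis sup_commute)+
    then have "lattice_rank z = Suc (lattice_rank (inf x z))"
      "lattice_rank x = Suc (lattice_rank (inf x z))"
      using less.hyps[of z "inf x z"] less.hyps[of x "inf z x"]
        lattice_rank_less[OF \<open>x < y\<close>] lattice_rank_less[OF z(1)]
      by (simp_all add: inf_commute)
    then show ?thesis using z by simp
  qed (use z in simp)
qed

text \<open>Climbing from \<open>a \<and> b\<close> to \<open>a\<close> along covers, each step transposes to a cover on the way from
  \<open>b\<close> to \<open>a \<or> b\<close>, so the rank increases by the same amount on both sides. The induction removes
  the last of these steps, from \<open>a'\<close> to \<open>a\<close>.\<close>

lemma rank_modular_law:
  fixes a b :: "'l::{finite,lattice}"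
  assumes mod: "modular_lattice TYPE('l)"
  shows "lattice_rank a + lattice_rank b = lattice_rank (inf a b) + lattice_rank (sup a b)"
proof (induction "lattice_rank a" arbitrary: a rule: less_induct)
  case less
  show ?case
  proof (cases "a \<le> b")
    case True
    then show ?thesis by (simp add: inf.absorb1 sup.absorb2)
  next
    case False
    let ?T = "{t. inf a b \<le> t \<and> t < a}"
    have "inf a b \<in> ?T" using False by (simp add: less_le) (metis inf_le2)
    then obtain a' where a': "a' \<in> ?T" and max: "\<And>t. t \<in> ?T \<Longrightarrow> a' \<le> t \<Longrightarrow> a' = t"
      using finite_has_maximal[of ?T] by auto
    have cov: "covered_by a' a"
      unfolding covered_by_def
    proof (intro conjI allI impI)
      fix t assume "a' \<le> t" "t \<le> a"
      then show "t = a' \<or> t = a" using max[of t] a' by (auto simp: less_le)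
    qed (use a' in simp)
    have "a' \<le> a" using a' by (simp add: less_imp_le)
    have inf_b: "inf a' b = inf a b"
      using a' \<open>a' \<le> a\<close> by (intro antisym) (auto intro: le_infI1)
    have inf_a: "inf (sup a' b) a = a'"
      using modular_latticeD[OF mod \<open>a' \<le> a\<close>, of b] a' by (simp add: inf_commute sup.absorb1)
    have "sup (sup a' b) a = sup a b"
      using \<open>a' \<le> a\<close> by (metis sup.absorb2 sup_assoc sup_commute)
    then have "covered_by (sup a' b) (sup a b)"
      using modular_covered_by_transpose[OF mod, of "sup a' b" a] cov inf_a by simp
    then have "lattice_rank (sup a b) = Suc (lattice_rank (sup a' b))"
      by (rule rank_covered_by[OF mod])
    moreover have "lattice_rank a = Suc (lattice_rank a')"
      using cov by (rule rank_covered_by[OF mod])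
    ultimately show ?thesis using less[of a'] inf_b by simp
  qed
qed


section \<open>Weights of monomials and degree reverse lexicographic orders\<close>

definition X :: "'v \<Rightarrow> 'v monom" where
  "X x = Poly_Mapping.single x 1"

abbreviation expo :: "'v monom \<Rightarrow> 'v \<Rightarrow> nat" where
  "expo \<equiv> Poly_Mapping.lookup"

definition weight :: "('v \<Rightarrow> nat) \<Rightarrow> 'v monom \<Rightarrow> nat" where
  "weight f m = (\<Sum>x\<in>Poly_Mapping.keys m. expo m x * f x)"

lemma weight_superset:
  assumes "finite S" "Poly_Mapping.keys m \<subseteq> S"
  shows "weight f m = (\<Sum>x\<in>S. expo m x * f x)"
  unfolding weight_def
  by (rule sum.mono_neutral_left) (use assms in \<open>auto simp: in_keys_iff\<close>)

lemma weight_add [simp]: "weight f (m + n) = weight f m + weight f n"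
proof -
  let ?S = "Poly_Mapping.keys m \<union> Poly_Mapping.keys n"
  have "weight f k = (\<Sum>x\<in>?S. expo k x * f x)" if "k \<in> {m, n, m + n}" for k
    using that by (intro weight_superset) (use keys_add[of m n] in auto)
  then show ?thesis by (simp add: lookup_add sum.distrib algebra_simps)
qed

lemma weight_X [simp]: "weight f (X x) = f x"
  by (simp add: weight_def X_def)

lemma weight_eq_0_iff: "weight f m = 0 \<longleftrightarrow> (\<forall>x\<in>Poly_Mapping.keys m. f x = 0)"
  by (auto simp: weight_def in_keys_iff)

lemma total_degree_eq_weight: "total_degree m = weight (\<lambda>_. 1) m"
  by (simp add: total_degree_def weight_def)

lemma total_degree_add [simp]: "total_degree (m + n) = total_degree m + total_degree n"
  by (simp add: total_degree_eq_weight)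

lemma total_degree_X [simp]: "total_degree (X x) = 1"
  by (simp add: total_degree_eq_weight)

lemma expo_X: "expo (X x) y = (if y = x then 1 else 0)"
  by (simp add: X_def lookup_single when_def)

lemma total_degree_eq_0_iff: "total_degree m = 0 \<longleftrightarrow> m = 0"
  by (auto simp: total_degree_eq_weight weight_eq_0_iff)

lemma key_factor:
  assumes "x \<in> Poly_Mapping.keys m"
  obtains n where "m = X x + n"
proof
  show "m = X x + (m - X x)"
    by (rule poly_mapping_eqI)
      (use assms in \<open>auto simp: lookup_add lookup_minus expo_X in_keys_iff\<close>)
qed

lemma key_pair_factor:
  assumes "x \<in> Poly_Mapping.keys m" "y \<in> Poly_Mapping.keys m" "x \<noteq> y"
  obtains u where "m = u + X x + X y"
proof -
  obtain n where n: "m = X x + n" using assms(1) by (rule key_factor)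
  then have "y \<in> Poly_Mapping.keys n"
    using assms(2,3) by (auto simp: in_keys_iff lookup_add expo_X)
  then obtain u where "n = X y + u" by (rule key_factor)
  then show thesis using n that by (metis add.commute add.assoc)
qed

lemma total_degree_2:
  assumes "total_degree m = 2"
  obtains x y where "m = X x + X y"
proof -
  have "m \<noteq> 0" using assms by (metis total_degree_eq_0_iff zero_neq_numeral)
  then obtain x where "x \<in> Poly_Mapping.keys m" by (metis keys_eq_empty equals0I)
  then obtain n where n: "m = X x + n" by (rule key_factor)
  then have "total_degree n = 1" using assms by simp
  then have "n \<noteq> 0" by (metis total_degree_eq_0_iff zero_neq_one)
  then obtain y where "y \<in> Poly_Mapping.keys n" by (metis keys_eq_empty equals0I)
  then obtain k where k: "n = X y + k" by (rule key_factor)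
  then have "k = 0" using \<open>total_degree n = 1\<close> by (simp add: total_degree_eq_0_iff)
  then show thesis using n k that by simp
qed

lemma finite_total_degree_eq:
  "finite {m :: 'v::finite monom. total_degree m = d}"
proof (rule finite_imageD)
  have "expo m x \<le> total_degree m" for m :: "'v monom" and x
    unfolding total_degree_def
    by (cases "x \<in> Poly_Mapping.keys m") (auto intro: member_le_sum simp: in_keys_iff)
  then have "expo ` {m :: 'v monom. total_degree m = d} \<subseteq> {f. \<forall>x. f x \<in> {..d}}"
    by auto
  moreover have "finite {f :: 'v \<Rightarrow> nat. \<forall>x. f x \<in> {..d}}"
    using finite_set_of_finite_funs[of "UNIV :: 'v set" "{..d}" 0] by simp
  ultimately show "finite (expo ` {m :: 'v monom. total_degree m = d})"
    by (rule finite_subset)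
  show "inj_on expo {m :: 'v monom. total_degree m = d}"
    by (simp add: inj_on_def poly_mapping.lookup_inject)
qed

lemma degrevlex_irrefl: "\<not> degrevlex r m m"
  by (simp add: degrevlex_def)

lemma degrevlex_add: "degrevlex r m n \<Longrightarrow> degrevlex r (m + t) (n + t)"
  by (simp add: degrevlex_def lookup_add)

lemma degrevlex_trans:
  assumes r: "strict_linear_order r" and "degrevlex r m n" "degrevlex r n p"
  shows "degrevlex r m p"
proof (cases "total_degree m = total_degree n \<and> total_degree n = total_degree p")
  case True
  obtain x where x: "expo n x < expo m x" "\<And>y. (y, x) \<in> r \<Longrightarrow> expo m y = expo n y"
    using assms(2) True by (auto simp: degrevlex_def)
  obtain z where z: "expo p z < expo n z" "\<And>y. (y, z) \<in> r \<Longrightarrow> expo n y = expo p y"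
    using assms(3) True by (auto simp: degrevlex_def)
  have tr: "\<And>u v w. (u, v) \<in> r \<Longrightarrow> (v, w) \<in> r \<Longrightarrow> (u, w) \<in> r"
    using r unfolding strict_linear_order_on_def by (meson transD)
  consider "x = z" | "(x, z) \<in> r" | "(z, x) \<in> r"
    using r unfolding strict_linear_order_on_def total_on_def by blast
  then have "\<exists>w. expo p w < expo m w \<and> (\<forall>y. (y, w) \<in> r \<longrightarrow> expo m y = expo p y)"
  proof cases
    case 1 then show ?thesis using x z by (intro exI[of _ x]) auto
  next
    case 2 then show ?thesis using x z(2) tr[OF _ 2] by (intro exI[of _ x]) auto
  next
    case 3 then show ?thesis using x(2) z tr[OF _ 3] by (intro exI[of _ z]) auto
  qed
  then show ?thesis using True by (simp add: degrevlex_def)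
next
  case False
  then show ?thesis using assms(2,3) by (auto simp: degrevlex_def)
qed

text \<open>The smallest variable at which \<open>m\<close> and \<open>n\<close> differ decides.\<close>

lemma degrevlex_total:
  fixes m n :: "'v::finite monom"
  assumes r: "strict_linear_order r" and "m \<noteq> n"
  shows "degrevlex r m n \<or> degrevlex r n m"
proof (cases "total_degree m = total_degree n")
  case True
  have "wf r"
    using r unfolding strict_linear_order_on_def
    by (intro finite_acyclic_wf finite) (simp add: acyclic_irrefl)
  moreover have "{x. expo m x \<noteq> expo n x} \<noteq> {}"
    using \<open>m \<noteq> n\<close> by (auto intro: poly_mapping_eqI)
  ultimately obtain x where "expo m x \<noteq> expo n x" "\<And>y. (y, x) \<in> r \<Longrightarrow> expo m y = expo n y"
    by (rule wfE_min') auto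
  then show ?thesis unfolding degrevlex_def using True by (metis linorder_neqE_nat)
qed (auto simp: degrevlex_def)

lemma degrevlex_order_on:
  fixes S :: "'v::finite monom set"
  assumes r: "strict_linear_order r"
  shows "transp_on S (degrevlex r)" "asymp_on S (degrevlex r)" "totalp_on S (degrevlex r)"
  using degrevlex_trans[OF r] degrevlex_total[OF r] degrevlex_irrefl[of r]
  by (blast intro: transp_onI asymp_onI totalp_onI)+

lemma degrevlex_least:
  fixes S :: "'v::finite monom set"
  assumes "strict_linear_order r" "finite S" "S \<noteq> {}"
  obtains m where "m \<in> S" "\<And>n. n \<in> S \<Longrightarrow> n \<noteq> m \<Longrightarrow> degrevlex r m n"
proof -
  have "\<exists>m\<in>S. \<forall>n\<in>S. n \<noteq> m \<longrightarrow> degrevlex r m n"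
    using assms(2,3) degrevlex_order_on[OF assms(1)] by (intro Finite_Set.bex_least_element)
  then show thesis using that by blast
qed

lemma degrevlex_greatest:
  fixes S :: "'v::finite monom set"
  assumes "strict_linear_order r" "finite S" "S \<noteq> {}"
  obtains m where "m \<in> S" "\<And>n. n \<in> S \<Longrightarrow> n \<noteq> m \<Longrightarrow> degrevlex r n m"
proof -
  have "\<exists>m\<in>S. \<forall>n\<in>S. n \<noteq> m \<longrightarrow> degrevlex r n m"
    using assms(2,3) degrevlex_order_on[OF assms(1)] by (intro Finite_Set.bex_greatest_element)
  then show thesis using that by blast
qed

text \<open>A reverse lexicographic comparison depends first on the exponents of the smallest
  variables, and \<open>z\<close> is the smallest variable at which the two monomials differ.\<close>

lemma degrevlex_smaller_variable:
  assumes r: "strict_linear_order r" and "(z, a) \<in> r" "(z, b) \<in> r" "(z, t) \<in> r"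
  shows "degrevlex r (u + X z + X t) (u + X a + X b)"
proof -
  have irr: "(x, x) \<notin> r" for x
    using r by (auto simp: strict_linear_order_on_def irrefl_def)
  have tr: "\<And>u v w. (u, v) \<in> r \<Longrightarrow> (v, w) \<in> r \<Longrightarrow> (u, w) \<in> r"
    using r unfolding strict_linear_order_on_def by (meson transD)
  show ?thesis
    unfolding degrevlex_def
  proof (intro disjI2 conjI exI[of _ z] allI impI)
    show "expo (u + X a + X b) z < expo (u + X z + X t) z"
    proof -
      have "z \<noteq> a" "z \<noteq> b" using assms irr by metis+
      then show ?thesis by (simp add: lookup_add expo_X)
    qed
    fix y assume "(y, z) \<in> r"
    \<comment> \<open>Below \<open>z\<close> there is none of the four exchanged variables.\<close>
    then have "y \<noteq> z" "(y, a) \<in> r" "(y, b) \<in> r" "(y, t) \<in> r"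
      using assms(2-4) irr tr[of y z] by auto
    then have "y \<noteq> z" "y \<noteq> a" "y \<noteq> b" "y \<noteq> t" using irr by auto
    then show "expo (u + X z + X t) y = expo (u + X a + X b) y"
      by (simp add: lookup_add expo_X)
  qed simp
qed

definition extends_rank :: "'l::{finite,lattice} rel \<Rightarrow> bool" where
  "extends_rank r \<longleftrightarrow>
     strict_linear_order r \<and> (\<forall>a b. lattice_rank b < lattice_rank a \<longrightarrow> (b, a) \<in> r)"

lemma extends_rank_less: "extends_rank r \<Longrightarrow> a < b \<Longrightarrow> (a, b) \<in> r"
  by (simp add: extends_rank_def lattice_rank_less)

lemma degrevlex_exchange:
  assumes "extends_rank r" "\<not> a \<le> b" "\<not> b \<le> a"
  shows "degrevlex r (u + X (inf a b) + X (sup a b)) (u + X a + X b)"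
proof (rule degrevlex_smaller_variable)
  show "strict_linear_order r" using assms(1) by (simp add: extends_rank_def)
  have "inf a b \<noteq> a" "inf a b \<noteq> b"
    using assms(2,3) by (metis inf_le1 inf_le2)+
  then have "inf a b < a" "inf a b < b" by (simp_all add: less_le)
  moreover from this have "inf a b < sup a b" by (meson less_le_trans sup_ge1)
  ultimately show "(inf a b, a) \<in> r" "(inf a b, b) \<in> r" "(inf a b, sup a b) \<in> r"
    using extends_rank_less[OF assms(1)] by blast+
qed

lemma extends_rank_exists: "\<exists>r :: 'l::{finite,lattice} rel. extends_rank r"
proof -
  obtain f :: "'l \<Rightarrow> nat" where "inj f"
    using finite_imp_inj_to_nat_seg[of "UNIV :: 'l set"] by auto
  then have "extends_rank {(b, a). lattice_rank b < lattice_rank a \<or>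
      lattice_rank b = lattice_rank a \<and> f b < f a}"
    unfolding extends_rank_def strict_linear_order_on_def
    by (auto simp: trans_def irrefl_def total_on_def) (metis injD linorder_neqE_nat)
  then show ?thesis by blast
qed

lemma initial_monomial_eqI:
  assumes r: "strict_linear_order r" and "m \<in> Poly_Mapping.keys f"
    and "\<And>n. n \<in> Poly_Mapping.keys f \<Longrightarrow> n \<noteq> m \<Longrightarrow> degrevlex r n m"
  shows "initial_monomial (degrevlex r) f = m"
  unfolding initial_monomial_def
proof (rule the_equality)
  fix k
  assume k: "k \<in> Poly_Mapping.keys f \<and>
    (\<forall>n\<in>Poly_Mapping.keys f. n \<noteq> k \<longrightarrow> degrevlex r n k)"
  show "k = m"
  proof (rule ccontr)
    assume "k \<noteq> m"
    then have "degrevlex r k m" "degrevlex r m k" using k assms(2,3) by auto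
    then show False using degrevlex_trans[OF r] degrevlex_irrefl by blast
  qed
qed (use assms in auto)

lemma initial_monomial:
  fixes f :: "('v::finite, 'k::zero) mpoly"
  assumes r: "strict_linear_order r" and "f \<noteq> 0"
  shows "initial_monomial (degrevlex r) f \<in> Poly_Mapping.keys f"
    and "\<And>n. n \<in> Poly_Mapping.keys f \<Longrightarrow> n \<noteq> initial_monomial (degrevlex r) f \<Longrightarrow>
           degrevlex r n (initial_monomial (degrevlex r) f)"
proof -
  obtain m where m: "m \<in> Poly_Mapping.keys f"
    "\<And>n. n \<in> Poly_Mapping.keys f \<Longrightarrow> n \<noteq> m \<Longrightarrow> degrevlex r n m"
    using degrevlex_greatest[OF r, of "Poly_Mapping.keys f"] \<open>f \<noteq> 0\<close> by auto
  then have "initial_monomial (degrevlex r) f = m" by (intro initial_monomial_eqI[OF r])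
  then show "initial_monomial (degrevlex r) f \<in> Poly_Mapping.keys f"
    "\<And>n. n \<in> Poly_Mapping.keys f \<Longrightarrow> n \<noteq> initial_monomial (degrevlex r) f \<Longrightarrow>
           degrevlex r n (initial_monomial (degrevlex r) f)"
    using m by auto
qed


section \<open>Monomials modulo exchanges\<close>

inductive exchange_equiv :: "'l::lattice monom \<Rightarrow> 'l monom \<Rightarrow> bool" for m where
  refl: "exchange_equiv m m"
| straighten: "exchange_equiv m (u + X a + X b) \<Longrightarrow>
    exchange_equiv m (u + X (inf a b) + X (sup a b))"
| unstraighten: "exchange_equiv m (u + X (inf a b) + X (sup a b)) \<Longrightarrow>
    exchange_equiv m (u + X a + X b)"

text \<open>Invariants of exchanges are most easily handled through the sets on which they are
  constant: an arbitrary property of monomials that exchanges preserve is a closed set.\<close>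

definition exchange_closed :: "'l::lattice monom set \<Rightarrow> bool" where
  "exchange_closed A \<longleftrightarrow>
     (\<forall>u a b. u + X a + X b \<in> A \<longleftrightarrow> u + X (inf a b) + X (sup a b) \<in> A)"

lemma exchange_closed_class: "exchange_closed {n. exchange_equiv m n}"
  by (auto simp: exchange_closed_def intro: exchange_equiv.intros)

lemma exchange_closed_mem:
  assumes "exchange_equiv m n" "exchange_closed A" "m \<in> A"
  shows "n \<in> A"
  using assms(1) by induction (use assms(2,3) in \<open>auto simp: exchange_closed_def\<close>)

lemma exchange_equiv_trans:
  "exchange_equiv m n \<Longrightarrow> exchange_equiv n p \<Longrightarrow> exchange_equiv m p"
  using exchange_closed_mem[OF _ exchange_closed_class] by blast

lemma exchange_equiv_sym:
  assumes "exchange_equiv m n" shows "exchange_equiv n m"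
  using assms
proof induction
  case refl
  show ?case by (rule exchange_equiv.refl)
next
  case (straighten u a b)
  show ?case
    by (rule exchange_equiv_trans[OF _ straighten.IH])
      (rule exchange_equiv.unstraighten, rule exchange_equiv.refl)
next
  case (unstraighten u a b)
  show ?case
    by (rule exchange_equiv_trans[OF _ unstraighten.IH])
      (rule exchange_equiv.straighten, rule exchange_equiv.refl)
qed

lemma exchange_equiv_add:
  assumes "exchange_equiv m n" shows "exchange_equiv (m + t) (n + t)"
proof -
  have "exchange_closed {n. exchange_equiv (m + t) (n + t)}"
    unfolding exchange_closed_def
  proof (intro allI)
    fix u a b
    have "exchange_equiv (m + t) ((u + t) + X a + X b) \<longleftrightarrow>
        exchange_equiv (m + t) ((u + t) + X (inf a b) + X (sup a b))"
      by (blast intro: exchange_equiv.intros)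
    then show "u + X a + X b \<in> {n. exchange_equiv (m + t) (n + t)} \<longleftrightarrow>
        u + X (inf a b) + X (sup a b) \<in> {n. exchange_equiv (m + t) (n + t)}"
      by (simp add: ac_simps)
  qed
  from exchange_closed_mem[OF assms this] show ?thesis by (simp add: exchange_equiv.refl)
qed

text \<open>Every valuation of the lattice, extended additively to monomials, is an invariant. It will
  be applied to the constant \<open>1\<close>, which gives the degree, and to the rank.\<close>

lemma exchange_equiv_weight:
  assumes "exchange_equiv m n" and "\<And>a b. f a + f b = f (inf a b) + f (sup a b)"
  shows "weight f m = weight f n"
proof -
  have "exchange_closed {n. weight f m = weight f n}"
    using assms(2) by (simp add: exchange_closed_def add.assoc)
  from exchange_closed_mem[OF assms(1) this] show ?thesis by simp
qed

lemma keys_add_monom [simp]: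
  "Poly_Mapping.keys (m + n :: 'v monom) = Poly_Mapping.keys m \<union> Poly_Mapping.keys n"
  by (auto simp: in_keys_iff lookup_add)

lemma keys_X [simp]: "Poly_Mapping.keys (X x) = {x}"
  by (simp add: X_def)

text \<open>The two products \<open>a b\<close> and \<open>(a \<and> b) (a \<or> b)\<close> have the same meet and the same join of their
  variables. Hence exchanges never leave an interval of the lattice.\<close>

lemma exchange_equiv_bounds:
  assumes "exchange_equiv m n"
  shows "(\<forall>x\<in>Poly_Mapping.keys m. z \<le> x) \<longleftrightarrow> (\<forall>x\<in>Poly_Mapping.keys n. z \<le> x)"
    and "(\<forall>x\<in>Poly_Mapping.keys m. x \<le> z) \<longleftrightarrow> (\<forall>x\<in>Poly_Mapping.keys n. x \<le> z)"
  using assms by induction (auto simp: ball_Un intro: le_supI1 le_infI1)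

lemma exchange_equiv_total_degree: "exchange_equiv m n \<Longrightarrow> total_degree m = total_degree n"
  unfolding total_degree_eq_weight by (rule exchange_equiv_weight) auto

lemma finite_exchange_class: "finite {n :: 'l::{finite,lattice} monom. exchange_equiv m n}"
  by (rule finite_subset[OF _ finite_total_degree_eq[of "total_degree m"]])
    (auto dest: exchange_equiv_total_degree)

definition chain_monom :: "'l::lattice monom \<Rightarrow> bool" where
  "chain_monom m \<longleftrightarrow> (\<forall>x\<in>Poly_Mapping.keys m. \<forall>y\<in>Poly_Mapping.keys m. x \<le> y \<or> y \<le> x)"

text \<open>Classes are finite, so a least element exists; straightening two incomparable
  variables would make it smaller.\<close>

lemma least_in_exchange_class:
  fixes m :: "'l::{finite,lattice} monom"
  assumes r: "extends_rank r"
  shows "\<exists>w. exchange_equiv m w \<and> chain_monom w \<and>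
    (\<forall>n. exchange_equiv m n \<longrightarrow> n \<noteq> w \<longrightarrow> degrevlex r w n)"
proof -
  have lin: "strict_linear_order r" using r by (simp add: extends_rank_def)
  have "m \<in> {n. exchange_equiv m n}" by (simp add: exchange_equiv.refl)
  then have "{n. exchange_equiv m n} \<noteq> {}" by blast
  from degrevlex_least[OF lin finite_exchange_class this]
  obtain w where w: "exchange_equiv m w"
    and least: "\<forall>n. exchange_equiv m n \<longrightarrow> n \<noteq> w \<longrightarrow> degrevlex r w n"
    by (metis mem_Collect_eq)
  have "chain_monom w"
    unfolding chain_monom_def
  proof (intro ballI, rule ccontr)
    fix x y assume xy: "x \<in> Poly_Mapping.keys w" "y \<in> Poly_Mapping.keys w"
      and "\<not> (x \<le> y \<or> y \<le> x)"
    then have inc: "\<not> x \<le> y" "\<not> y \<le> x" "x \<noteq> y" by auto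
    obtain u where u: "w = u + X x + X y" using xy inc(3) by (rule key_pair_factor)
    let ?n = "u + X (inf x y) + X (sup x y)"
    have "degrevlex r ?n w" unfolding u using r inc(1,2) by (rule degrevlex_exchange)
    moreover have "exchange_equiv m ?n"
      using w unfolding u by (rule exchange_equiv.straighten)
    ultimately show False using least degrevlex_trans[OF lin] degrevlex_irrefl by blast
  qed
  with w least show ?thesis by blast
qed


section \<open>The lattice ideal and its initial ideal\<close>

interpretation poly_module: module "(*) :: 'a::comm_ring_1 \<Rightarrow> 'a \<Rightarrow> 'a"
  by (rule module_times)

lemma monomial_add: "monomial (m + n) = (monomial m * monomial n :: ('v, 'k::comm_ring_1) mpoly)"
  by (simp add: monomial_def mult_single)

lemma keys_monomial [simp]: "Poly_Mapping.keys (monomial m) = {m}"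
  by (simp add: monomial_def)

lemma ideal_generated_by_diff:
  "f \<in> ideal_generated_by S \<Longrightarrow> g \<in> ideal_generated_by S \<Longrightarrow> f - g \<in> ideal_generated_by S"
  unfolding ideal_generated_by_def by (rule poly_module.span_diff)

lemma ideal_generated_by_add:
  "f \<in> ideal_generated_by S \<Longrightarrow> g \<in> ideal_generated_by S \<Longrightarrow> f + g \<in> ideal_generated_by S"
  unfolding ideal_generated_by_def by (rule poly_module.span_add)

lemma poly_mapping_sum_single:
  "f = (\<Sum>m\<in>Poly_Mapping.keys f. Poly_Mapping.single m (Poly_Mapping.lookup f m))"
proof (rule poly_mapping_eqI)
  fix k
  show "Poly_Mapping.lookup f k = Poly_Mapping.lookup
      (\<Sum>m\<in>Poly_Mapping.keys f. Poly_Mapping.single m (Poly_Mapping.lookup f m)) k"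
    by (simp add: lookup_sum lookup_single when_def sum.delta' in_keys_iff)
qed

lemma var_eq: "var x = monomial (X x)"
  by (simp add: var_def X_def)

lemma straightening_relation:
  "monomial u * (var a * var b - var (inf a b) * var (sup a b)) =
     monomial (u + X a + X b) -
     (monomial (u + X (inf a b) + X (sup a b)) :: ('v::lattice, 'k::comm_ring_1) mpoly)"
  by (simp only: var_eq monomial_add right_diff_distrib mult.assoc)

lemma exchange_equiv_imp_diff_in_ideal:
  assumes "exchange_equiv m n"
  shows "monomial m - monomial n \<in> (lattice_ideal :: ('l::lattice, 'k::comm_ring_1) mpoly set)"
proof -
  have rel: "monomial (u + X a + X b) - monomial (u + X (inf a b) + X (sup a b))
      \<in> (lattice_ideal :: ('l, 'k) mpoly set)" for u a b
    unfolding straightening_relation[symmetric] lattice_ideal_def ideal_generated_by_def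
    by (rule poly_module.span_scale, rule poly_module.span_base) (auto simp: basic_binomials_def)
  show ?thesis
    using assms
  proof induction
    case refl
    then show ?case
      by (simp add: lattice_ideal_def ideal_generated_by_def poly_module.span_zero)
  next
    case (straighten u a b)
    from ideal_generated_by_add[OF this(2)[unfolded lattice_ideal_def]
        rel[of u a b, unfolded lattice_ideal_def]]
    show ?case by (simp add: lattice_ideal_def)
  next
    case (unstraighten u a b)
    from ideal_generated_by_diff[OF this(2)[unfolded lattice_ideal_def]
        rel[of u a b, unfolded lattice_ideal_def]]
    show ?case by (simp add: lattice_ideal_def)
  qed
qed

text \<open>The linear functional that adds up the coefficients of the monomials in \<open>A\<close>. For closed
  sets \<open>A\<close> these functionals detect which polynomials can lie in the ideal.\<close>

definition coeff_sum :: "'v monom set \<Rightarrow> ('v, 'k::comm_ring_1) mpoly \<Rightarrow> 'k" where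
  "coeff_sum A f = (\<Sum>m\<in>Poly_Mapping.keys f. if m \<in> A then Poly_Mapping.lookup f m else 0)"

lemma coeff_sum_superset:
  assumes "finite S" "Poly_Mapping.keys f \<subseteq> S"
  shows "coeff_sum A f = (\<Sum>m\<in>S. if m \<in> A then Poly_Mapping.lookup f m else 0)"
  unfolding coeff_sum_def
  by (rule sum.mono_neutral_left) (use assms in \<open>auto simp: in_keys_iff\<close>)

lemma coeff_sum_add: "coeff_sum A (f + g) = coeff_sum A f + coeff_sum A g"
proof -
  let ?S = "Poly_Mapping.keys f \<union> Poly_Mapping.keys g"
  have eq: "coeff_sum A h = (\<Sum>m\<in>?S. if m \<in> A then Poly_Mapping.lookup h m else 0)"
    if "h \<in> {f, g, f + g}" for h
    using that by (intro coeff_sum_superset) (use Poly_Mapping.keys_add[of f g] in auto)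
  then have "coeff_sum A f + coeff_sum A g = (\<Sum>m\<in>?S.
      (if m \<in> A then Poly_Mapping.lookup f m else 0) +
      (if m \<in> A then Poly_Mapping.lookup g m else 0))"
    by (simp add: sum.distrib)
  also have "\<dots> = (\<Sum>m\<in>?S. if m \<in> A then Poly_Mapping.lookup (f + g) m else 0)"
    by (rule sum.cong) (auto simp: lookup_add)
  also have "\<dots> = coeff_sum A (f + g)" using eq by simp
  finally show ?thesis by (rule sym)
qed

lemma coeff_sum_single:
  "coeff_sum A (Poly_Mapping.single m c) = (if m \<in> A then c else 0)"
  by (simp add: coeff_sum_def)

lemma coeff_sum_0: "coeff_sum A 0 = 0"
  by (simp add: coeff_sum_def)

lemma coeff_sum_sum: "coeff_sum A (sum g B) = (\<Sum>i\<in>B. coeff_sum A (g i))"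
  by (induction B rule: infinite_finite_induct) (simp_all add: coeff_sum_add coeff_sum_0)

text \<open>A generator times a term has two monomials that are related by an exchange and carry
  opposite coefficients. Either both of them are in \<open>A\<close> or neither is.\<close>

lemma coeff_sum_lattice_ideal:
  assumes A: "exchange_closed A"
    and "f \<in> (lattice_ideal :: ('l::lattice, 'k::comm_ring_1) mpoly set)"
  shows "coeff_sum A f = 0"
  using assms(2) unfolding lattice_ideal_def ideal_generated_by_def
proof (induction rule: poly_module.span_induct_alt)
  case base
  show ?case by (rule coeff_sum_0)
next
  case (step c x y)
  then obtain a b where x: "x = var a * var b - var (inf a b) * var (sup a b)"
    by (auto simp: basic_binomials_def)
  have single_term: "coeff_sum A (Poly_Mapping.single u k * x) = 0" for u k
  proof -
    have eq: "Poly_Mapping.single u k * x = Poly_Mapping.single (u + X a + X b) k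
        + Poly_Mapping.single (u + X (inf a b) + X (sup a b)) (- k)"
      by (simp only: x var_eq monomial_def diff_conv_add_uminus distrib_left mult_minus_right
          mult_single mult_1_right add.assoc single_uminus)
    show ?thesis
      using A by (simp add: eq coeff_sum_add coeff_sum_single exchange_closed_def)
  qed
  have "c * x = (\<Sum>u\<in>Poly_Mapping.keys c. Poly_Mapping.single u (Poly_Mapping.lookup c u) * x)"
    unfolding sum_distrib_right[symmetric]
    by (rule arg_cong[where f = "\<lambda>f. f * x", OF poly_mapping_sum_single])
  then show ?case using step single_term by (simp add: coeff_sum_add coeff_sum_sum)
qed

lemma lattice_ideal_second_key:
  fixes f :: "('l::lattice, 'k::comm_ring_1) mpoly"
  assumes "f \<in> lattice_ideal" "exchange_closed A" "m \<in> Poly_Mapping.keys f" "m \<in> A"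
  shows "\<exists>n\<in>Poly_Mapping.keys f. n \<in> A \<and> n \<noteq> m"
proof (rule ccontr)
  assume no_key: "\<not> (\<exists>n\<in>Poly_Mapping.keys f. n \<in> A \<and> n \<noteq> m)"
  have "n \<in> A \<longleftrightarrow> n = m" if "n \<in> Poly_Mapping.keys f" for n
    using no_key \<open>m \<in> A\<close> that by blast
  then have "coeff_sum A f =
      (\<Sum>n\<in>Poly_Mapping.keys f. if n = m then Poly_Mapping.lookup f n else 0)"
    unfolding coeff_sum_def by (intro sum.cong) simp_all
  also have "\<dots> = Poly_Mapping.lookup f m" using assms(3) by (simp add: sum.delta)
  finally show False
    using coeff_sum_lattice_ideal[OF assms(2,1)] assms(3) by (simp add: in_keys_iff)
qed

text \<open>Every term of every element of a monomial ideal is divisible by a generator, since this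
  property passes to sums and multiples.\<close>

lemma monomial_in_monomial_ideal:
  assumes "monomial m \<in> ideal_generated_by
      (monomial ` S :: ('v, 'k::comm_ring_1) mpoly set)"
  shows "\<exists>s\<in>S. \<exists>t. m = s + t"
proof -
  have "\<forall>n\<in>Poly_Mapping.keys f. \<exists>s\<in>S. \<exists>t. n = s + t"
    if "f \<in> ideal_generated_by (monomial ` S :: ('v, 'k) mpoly set)" for f
    using that unfolding ideal_generated_by_def
  proof (induction rule: poly_module.span_induct_alt)
    case base
    then show ?case by simp
  next
    case (step c x y)
    then obtain s where s: "s \<in> S" "x = monomial s" by blast
    show ?case
    proof
      fix n assume "n \<in> Poly_Mapping.keys (c * x + y)"
      then consider "n \<in> Poly_Mapping.keys (c * x)" | "n \<in> Poly_Mapping.keys y"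
        using Poly_Mapping.keys_add[of "c * x" y] by blast
      then show "\<exists>s\<in>S. \<exists>t. n = s + t"
      proof cases
        case 1
        then obtain u where "n = u + s"
          using Poly_Mapping.keys_mult[of c x] s(2) by (auto simp: monomial_def)
        then show ?thesis using s(1) by (metis add.commute)
      qed (use step in blast)
    qed
  qed
  from this[OF assms] show ?thesis by simp
qed

lemma initial_monomial_binomial:
  fixes m n :: "'v::finite monom"
  assumes r: "strict_linear_order r" and less: "degrevlex r n m"
  shows "initial_monomial (degrevlex r) (monomial m - monomial n :: ('v, 'k::comm_ring_1) mpoly) = m"
    and "monomial m - monomial n \<noteq> (0 :: ('v, 'k) mpoly)"
proof -
  have "m \<noteq> n" using less degrevlex_irrefl by blast
  let ?f = "monomial m - monomial n :: ('v, 'k) mpoly"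
  have keys: "Poly_Mapping.keys ?f = {m, n}"
    using \<open>m \<noteq> n\<close>
    by (auto simp: in_keys_iff lookup_minus monomial_def lookup_single when_def split: if_splits)
  show "initial_monomial (degrevlex r) ?f = m"
    by (rule initial_monomial_eqI[OF r]) (use keys less in auto)
  show "?f \<noteq> 0" using keys by auto
qed

lemma monomial_in_initial_ideal:
  fixes m n :: "'l::{finite,lattice} monom"
  assumes "strict_linear_order r" "exchange_equiv m n" "degrevlex r n m"
  shows "monomial m \<in> initial_ideal (degrevlex r) (lattice_ideal :: ('l, 'k::comm_ring_1) mpoly set)"
proof -
  let ?f = "monomial m - monomial n :: ('l, 'k) mpoly"
  have "?f \<in> lattice_ideal" by (rule exchange_equiv_imp_diff_in_ideal[OF assms(2)])
  then show ?thesis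
    unfolding initial_ideal_def ideal_generated_by_def
    using initial_monomial_binomial[OF assms(1,3), where 'k = 'k]
    by (intro poly_module.span_base CollectI exI[of _ ?f]) simp
qed

text \<open>The coefficients in \<open>A\<close> sum to zero, so the initial term is cancelled by another term whose
  monomial is in \<open>A\<close>, and that monomial is smaller.\<close>

lemma initial_monomial_not_least:
  fixes f :: "('l::{finite,lattice}, 'k::comm_ring_1) mpoly"
  assumes r: "strict_linear_order r" and f: "f \<in> lattice_ideal" "f \<noteq> 0"
    and A: "exchange_closed A" "initial_monomial (degrevlex r) f \<in> A"
  shows "\<exists>n\<in>A. degrevlex r n (initial_monomial (degrevlex r) f)"
proof -
  obtain n where "n \<in> Poly_Mapping.keys f" "n \<in> A" "n \<noteq> initial_monomial (degrevlex r) f"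
    using initial_monomial(1)[OF r f(2)] lattice_ideal_second_key[OF f(1) A(1) _ A(2)] by blast
  then show ?thesis using initial_monomial(2)[OF r f(2)] by blast
qed


section \<open>Distributive lattices: chain monomials\<close>

text \<open>The bottom element is deliberately admitted: counting the entries above it gives the
  degree, which \<open>chain_monom_unique\<close> needs.\<close>

definition join_prime :: "'l::lattice \<Rightarrow> bool" where
  "join_prime p \<longleftrightarrow> (\<forall>a b. p \<le> sup a b \<longrightarrow> p \<le> a \<or> p \<le> b)"

definition count_above :: "'l::lattice \<Rightarrow> 'l monom \<Rightarrow> nat" where
  "count_above p = weight (\<lambda>x. if p \<le> x then 1 else 0)"

lemma join_prime_bottom: "join_prime (Inf_fin UNIV :: 'l::{finite,lattice})"
  by (simp add: join_prime_def Inf_fin_UNIV_le)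

text \<open>A minimal element \<open>p\<close> among those below \<open>x\<close> but not below \<open>y\<close> will do. If \<open>p \<le> a \<or> b\<close>, then
  \<open>p = (p \<and> a) \<or> (p \<and> b)\<close> by distributivity, and if both meets were proper, minimality would
  place them, and hence \<open>p\<close>, below \<open>y\<close>.\<close>

lemma join_prime_separates:
  fixes x y :: "'l::{finite,lattice}"
  assumes dist: "distributive_lattice TYPE('l)" and "\<not> x \<le> y"
  obtains p where "join_prime p" "p \<le> x" "\<not> p \<le> y"
proof -
  let ?Z = "{z. z \<le> x \<and> \<not> z \<le> y}"
  obtain p where p: "p \<in> ?Z" and min: "\<And>z. z \<in> ?Z \<Longrightarrow> z \<le> p \<Longrightarrow> p = z"
    using finite_has_minimal[of ?Z] assms(2) by auto
  have "join_prime p"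
    unfolding join_prime_def
  proof (intro allI impI, rule ccontr)
    fix a b assume le: "p \<le> sup a b" and "\<not> (p \<le> a \<or> p \<le> b)"
    then have "inf p a \<noteq> p" "inf p b \<noteq> p" by (metis inf_le2)+
    then have "inf p a \<le> y" "inf p b \<le> y"
      using min[of "inf p a"] min[of "inf p b"] p by (auto intro: le_infI1)
    then have "sup (inf p a) (inf p b) \<le> y" by simp
    moreover have "sup (inf p a) (inf p b) = p"
      using dist le unfolding distributive_lattice_def by (metis inf.absorb1)
    ultimately show False using p by simp
  qed
  then show thesis using that p by blast
qed

text \<open>An element \<open>p\<close> is below both of \<open>a\<close>, \<open>b\<close> if and only if it is below \<open>a \<and> b\<close>, and, when it is
  join-prime, below at least one of them if and only if it is below \<open>a \<or> b\<close>.\<close>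

lemma exchange_closed_count_above:
  "exchange_closed {n. \<forall>p. join_prime p \<longrightarrow> count_above p n = count_above p m}"
proof -
  have "(if p \<le> a then 1 else 0) + (if p \<le> b then 1 else 0) =
      (if p \<le> inf a b then 1 else 0) + (if p \<le> sup a b then 1 else 0 :: nat)"
    if "join_prime p" for p a b :: 'a
    using that by (auto simp: join_prime_def intro: le_supI1 le_supI2)
  then show ?thesis
    unfolding exchange_closed_def count_above_def by (auto simp: add.assoc)
qed

lemma chain_monom_top:
  fixes m :: "'l::lattice monom"
  assumes "chain_monom m" "m \<noteq> 0"
  obtains x where "x \<in> Poly_Mapping.keys m" "\<And>y. y \<in> Poly_Mapping.keys m \<Longrightarrow> y \<le> x"
proof -
  obtain x where "x \<in> Poly_Mapping.keys m"
    "\<And>y. y \<in> Poly_Mapping.keys m \<Longrightarrow> x \<le> y \<Longrightarrow> x = y"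
    using finite_has_maximal[of "Poly_Mapping.keys m"] assms(2) by auto
  then show thesis using that assms(1) unfolding chain_monom_def by blast
qed

lemma count_above_eq_0_iff: "count_above p m = 0 \<longleftrightarrow> (\<forall>x\<in>Poly_Mapping.keys m. \<not> p \<le> x)"
  by (auto simp: count_above_def weight_eq_0_iff)

text \<open>The largest entries of the two chains agree, because a join-prime element separating them
  would be below some entry of one monomial and of none in the other. Cancelling the common
  largest entry reduces the degree.\<close>

lemma chain_monom_unique:
  fixes m n :: "'l::{finite,lattice} monom"
  assumes dist: "distributive_lattice TYPE('l)"
    and "chain_monom m" "chain_monom n"
    and "\<And>p. join_prime p \<Longrightarrow> count_above p m = count_above p n"
  shows "m = n"
  using assms(2-)
proof (induction "total_degree m" arbitrary: m n)
  case 0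
  then have "m = 0" by (simp add: total_degree_eq_0_iff)
  then have "count_above (Inf_fin UNIV) m = 0" by (simp add: count_above_eq_0_iff)
  then have "count_above (Inf_fin UNIV) n = 0"
    using 0(4)[OF join_prime_bottom] by simp
  then have "Poly_Mapping.keys n = {}" by (auto simp: count_above_eq_0_iff Inf_fin_UNIV_le)
  then show ?case using \<open>m = 0\<close> by simp
next
  case (Suc d)
  note count = Suc.prems(3)
  have "m \<noteq> 0" using Suc.hyps(2) by (metis total_degree_eq_0_iff nat.distinct(1))
  then obtain x where x: "x \<in> Poly_Mapping.keys m" "\<And>y. y \<in> Poly_Mapping.keys m \<Longrightarrow> y \<le> x"
    using Suc.prems(1) by (metis chain_monom_top)
  have "count_above (Inf_fin UNIV) m \<noteq> 0"
    using x(1) by (auto simp: count_above_eq_0_iff Inf_fin_UNIV_le)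
  then have "n \<noteq> 0"
    using count[OF join_prime_bottom] by (auto simp: count_above_eq_0_iff)
  then obtain y where y: "y \<in> Poly_Mapping.keys n" "\<And>z. z \<in> Poly_Mapping.keys n \<Longrightarrow> z \<le> y"
    using Suc.prems(2) by (metis chain_monom_top)
  have top_le: "x' \<le> y'"
    if "x' \<in> Poly_Mapping.keys m'" "\<And>z. z \<in> Poly_Mapping.keys n' \<Longrightarrow> z \<le> y'"
      "\<And>p. join_prime p \<Longrightarrow> count_above p m' = count_above p n'" for m' n' and x' y' :: 'l
  proof (rule ccontr)
    assume "\<not> x' \<le> y'"
    then obtain p where p: "join_prime p" "p \<le> x'" "\<not> p \<le> y'"
      by (rule join_prime_separates[OF dist])
    then have "count_above p n' = 0" "count_above p m' \<noteq> 0"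
      unfolding count_above_eq_0_iff using that(1,2) by (auto intro: order_trans)
    then show False using that(3) p(1) by simp
  qed
  have "x = y"
    using top_le[OF x(1) y(2) count] top_le[OF y(1) x(2) count[symmetric]] by simp
  obtain m' where m': "m = X x + m'" using x(1) by (rule key_factor)
  obtain n' where n': "n = X x + n'" using y(1) unfolding \<open>x = y\<close> by (rule key_factor)
  have "m' = n'"
  proof (rule Suc.hyps(1))
    show "d = total_degree m'" using Suc.hyps(2) m' by simp
    show "chain_monom m'" "chain_monom n'"
      using Suc.prems(1,2) unfolding m' n' chain_monom_def by simp_all
    show "count_above p m' = count_above p n'" if "join_prime p" for p
      using count[OF that] by (simp add: m' n' count_above_def)
  qed
  then show ?case by (simp add: m' n')
qed

text \<open>The basic binomials of incomparable pairs form a Groebner basis. The point is that the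
  initial monomial \<open>m\<close> of an element of the ideal is never supported on a chain. Some smaller
  monomial \<open>n\<close> has the same counts above join-primes as \<open>m\<close>, and so has the least monomial of the
  class of \<open>n\<close>; that one is a chain monomial and differs from \<open>m\<close>, so \<open>m\<close> is not a chain
  monomial.\<close>

lemma distributive_imp_squarefree:
  fixes r :: "'l::{finite,lattice} rel"
  assumes dist: "distributive_lattice TYPE('l)" and r: "extends_rank r"
  shows "has_squarefree_groebner_basis (degrevlex r)
    (lattice_ideal :: ('l, 'k::comm_ring_1) mpoly set)"
proof -
  let ?I = "lattice_ideal :: ('l, 'k) mpoly set"
  let ?in = "initial_monomial (degrevlex r) :: ('l, 'k) mpoly \<Rightarrow> _"
  let ?g = "\<lambda>(a, b). monomial (X a + X b) - monomial (X (inf a b) + X (sup a b)) :: ('l, 'k) mpoly"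
  let ?P = "{(a, b). \<not> a \<le> b \<and> \<not> b \<le> a}"
  have lin: "strict_linear_order r" using r by (simp add: extends_rank_def)
  have equiv: "exchange_equiv (X a + X b) (X (inf a b) + X (sup a b))" for a b :: 'l
    using exchange_equiv.straighten[of "X a + X b" 0 a b] by (simp add: exchange_equiv.refl)
  have in_g: "?in (?g (a, b)) = X a + X b" and g_neq_0: "?g (a, b) \<noteq> 0"
    if "(a, b) \<in> ?P" for a b
    using initial_monomial_binomial[OF lin, where 'k = 'k] degrevlex_exchange[OF r, of a b 0] that
    by simp_all
  have g_in: "?g (a, b) \<in> ?I" for a b
    using exchange_equiv_imp_diff_in_ideal[OF equiv] by simp
  have "monomial (?in f) \<in> ideal_generated_by {monomial (?in g) | g. g \<in> ?g ` ?P}"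
    if f: "f \<in> ?I" "f \<noteq> 0" for f
  proof -
    let ?m = "?in f"
    let ?A = "{n. \<forall>p. join_prime p \<longrightarrow> count_above p n = count_above p ?m}"
    have "\<not> chain_monom ?m"
    proof
      assume chain: "chain_monom ?m"
      obtain n where n: "n \<in> ?A" "degrevlex r n ?m"
        using initial_monomial_not_least[OF lin f exchange_closed_count_above, of ?m] by blast
      obtain k where k: "exchange_equiv n k" "chain_monom k"
        and least: "\<forall>j. exchange_equiv n j \<longrightarrow> j \<noteq> k \<longrightarrow> degrevlex r k j"
        using least_in_exchange_class[OF r, of n] by (elim exE conjE)
      have "k \<in> ?A"
        using exchange_closed_mem[OF _ exchange_closed_count_above n(1)] k(1) by blast
      then have "k = ?m" using chain_monom_unique[OF dist k(2) chain] by simp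
      then show False
        using least n(2) exchange_equiv.refl degrevlex_trans[OF lin] degrevlex_irrefl by blast
    qed
    then obtain x y where xy: "x \<in> Poly_Mapping.keys ?m" "y \<in> Poly_Mapping.keys ?m"
      "\<not> x \<le> y" "\<not> y \<le> x"
      unfolding chain_monom_def by blast
    then have "x \<noteq> y" by auto
    with xy(1,2) obtain u where u: "?m = u + X x + X y" by (rule key_pair_factor)
    have "monomial (X x + X y) \<in> {monomial (?in g) | g. g \<in> ?g ` ?P}"
      using xy(3,4) in_g[of x y] by force
    then have "monomial u * monomial (X x + X y)
        \<in> ideal_generated_by {monomial (?in g) | g. g \<in> ?g ` ?P}"
      unfolding ideal_generated_by_def by (intro poly_module.span_scale poly_module.span_base)
    then show ?thesis by (simp add: u monomial_add[symmetric] add.assoc)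
  qed
  then have sub: "{monomial (?in f) | f. f \<in> ?I \<and> f \<noteq> 0}
      \<subseteq> ideal_generated_by {monomial (?in g) | g. g \<in> ?g ` ?P}"
    by blast
  have sup: "{monomial (?in g) | g. g \<in> ?g ` ?P}
      \<subseteq> {monomial (?in f) | f. f \<in> ?I \<and> f \<noteq> 0}"
    using g_in g_neq_0 by blast
  have "is_groebner_basis (degrevlex r) ?I (?g ` ?P)"
    unfolding is_groebner_basis_def initial_ideal_def
  proof (intro conjI)
    show "?g ` ?P \<subseteq> ?I" using g_in by auto
    show "0 \<notin> ?g ` ?P" using g_neq_0 by force
    show "ideal_generated_by {monomial (?in g) | g. g \<in> ?g ` ?P} =
        ideal_generated_by {monomial (?in f) | f. f \<in> ?I \<and> f \<noteq> 0}"
      using sub sup unfolding ideal_generated_by_def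
      by (intro antisym poly_module.span_mono poly_module.span_minimal) auto
  qed simp
  moreover have "squarefree_monom (?in g)" if "g \<in> ?g ` ?P" for g
    using that in_g by (auto simp: squarefree_monom_def lookup_add expo_X)
  ultimately show ?thesis unfolding has_squarefree_groebner_basis_def by blast
qed


section \<open>Modular lattices that are not distributive\<close>

text \<open>Straightening first the pair \<open>x\<close>, \<open>y\<close> and then twice more brings the meet and the join of
  all three into place. The result is supported on a chain, but in general its middle entry
  depends on the pair with which the process begins.\<close>

lemma straighten_triple:
  "exchange_equiv (X x + X y + X z)
     (X (inf (inf x y) z) + X (sup (inf x y) (inf (sup x y) z)) + X (sup (sup x y) z))"
proof -
  have "exchange_equiv (X x + X y + X z) (X z + X x + X y)"
    by (simp add: ac_simps exchange_equiv.refl)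
  then have "exchange_equiv (X x + X y + X z) (X z + X (inf x y) + X (sup x y))"
    by (rule exchange_equiv.straighten)
  then have "exchange_equiv (X x + X y + X z) (X (inf x y) + X (sup x y) + X z)"
    by (simp add: ac_simps)
  then have "exchange_equiv (X x + X y + X z)
      (X (inf x y) + X (inf (sup x y) z) + X (sup (sup x y) z))"
    by (rule exchange_equiv.straighten)
  then have "exchange_equiv (X x + X y + X z)
      (X (sup (sup x y) z) + X (inf x y) + X (inf (sup x y) z))"
    by (simp add: ac_simps)
  then have "exchange_equiv (X x + X y + X z)
      (X (sup (sup x y) z) + X (inf (inf x y) (inf (sup x y) z))
        + X (sup (inf x y) (inf (sup x y) z)))"
    by (rule exchange_equiv.straighten)
  moreover have "inf (inf x y) (inf (sup x y) z) = inf (inf x y) z"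
    by (metis inf.absorb1 inf.assoc inf_le1 le_supI1)
  ultimately show ?thesis by (simp add: ac_simps)
qed

text \<open>Let \<open>a\<close> and \<open>b\<close> be the middle entries obtained by straightening \<open>x y z\<close> and \<open>y z x\<close>. By
  modularity their meets with \<open>x\<close> are precisely the two sides of the distributive law for \<open>x\<close>,
  \<open>y\<close>, \<open>z\<close>, so that \<open>a \<noteq> b\<close> whenever this law fails.\<close>

lemma non_distributive_equivalent_triples:
  assumes mod: "modular_lattice TYPE('l::lattice)"
    and ndist: "\<not> distributive_lattice TYPE('l::lattice)"
  obtains l a b h :: "'l::lattice" where "a \<noteq> b" "l \<le> a" "a \<le> h" "l \<le> b" "b \<le> h"
    "exchange_equiv (X l + X a + X h) (X l + X b + X h)"
proof -
  have "\<exists>x y z :: 'l. inf x (sup y z) \<noteq> sup (inf x y) (inf x z)"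
    using ndist distrib_imp1[where 'a = 'l] unfolding distributive_lattice_def by blast
  then obtain x y z :: 'l where xyz: "inf x (sup y z) \<noteq> sup (inf x y) (inf x z)" by blast
  define l where "l = inf (inf x y) z"
  define h where "h = sup (sup x y) z"
  define a where "a = sup (inf x y) (inf (sup x y) z)"
  define b where "b = sup (inf y z) (inf (sup y z) x)"
  have "inf a x = sup (inf x y) (inf (inf (sup x y) z) x)"
    unfolding a_def by (rule modular_latticeD[OF mod, symmetric]) simp
  also have "inf (inf (sup x y) z) x = inf x z"
    by (metis inf.absorb2 inf.commute inf.left_commute sup_ge1)
  finally have a: "inf a x = sup (inf x y) (inf x z)" .
  have "inf b x = sup (inf (sup y z) x) (inf (inf y z) x)"
    unfolding b_def sup_commute[of "inf y z"]
    by (rule modular_latticeD[OF mod, symmetric]) simp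
  also have "\<dots> = inf (sup y z) x"
    by (rule sup.absorb1) (meson inf_le1 inf_mono le_supI1 order_refl)
  finally have b: "inf b x = inf x (sup y z)" by (simp add: inf_commute)
  have "exchange_equiv (X x + X y + X z) (X l + X a + X h)"
    unfolding l_def a_def h_def by (rule straighten_triple)
  moreover have "exchange_equiv (X x + X y + X z) (X l + X b + X h)"
    using straighten_triple[of y z x] by (simp add: l_def b_def h_def ac_simps)
  ultimately have "exchange_equiv (X l + X a + X h) (X l + X b + X h)"
    by (meson exchange_equiv_sym exchange_equiv_trans)
  moreover have "a \<noteq> b" using a b xyz by auto
  moreover have "l \<le> inf x y" "l \<le> inf y z"
    by (auto simp: l_def intro: le_infI1)
  then have "l \<le> a" "l \<le> b" unfolding a_def b_def by (auto intro: le_supI1)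
  moreover have "a \<le> h" "b \<le> h"
    unfolding a_def b_def h_def by (auto intro: le_supI1 le_supI2 le_infI1 le_infI2)
  ultimately show thesis using that by blast
qed

text \<open>The class stays inside the interval \<open>[l, h]\<close>, whose smallest variable is \<open>l\<close>. Its least
  monomial \<open>w\<close> contains \<open>l\<close>, as otherwise it would be larger than \<open>l a h\<close>. The other two
  entries are comparable, and the larger one equals \<open>h\<close> since the join of all entries is \<open>h\<close>.
  The rank of the remaining entry follows by comparing sums of ranks.\<close>

lemma least_in_class_of_triple:
  fixes l a h :: "'l::{finite,lattice}"
  assumes mod: "modular_lattice TYPE('l)" and r: "extends_rank r" and "l \<le> a" "a \<le> h"
  obtains c where "exchange_equiv (X l + X a + X h) (X l + X c + X h)"
    "lattice_rank c = lattice_rank a"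
    "\<forall>n. exchange_equiv (X l + X a + X h) n \<longrightarrow> n \<noteq> X l + X c + X h \<longrightarrow>
       degrevlex r (X l + X c + X h) n"
proof -
  let ?p = "X l + X a + X h"
  have lin: "strict_linear_order r" using r by (simp add: extends_rank_def)
  obtain w where w: "exchange_equiv ?p w" and chain: "chain_monom w"
    and min: "\<forall>n. exchange_equiv ?p n \<longrightarrow> n \<noteq> w \<longrightarrow> degrevlex r w n"
    using least_in_exchange_class[OF r, of ?p] by (elim exE conjE)
  have "l \<le> h" using assms(3,4) by (rule order_trans)
  have deg: "total_degree w = 3"
    unfolding exchange_equiv_total_degree[OF w, symmetric] by simp
  have keys_p: "Poly_Mapping.keys ?p = {l, a, h}" by auto
  have lower: "\<forall>x\<in>Poly_Mapping.keys w. l \<le> x"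
    unfolding exchange_equiv_bounds(1)[OF w, symmetric] keys_p using assms(3) \<open>l \<le> h\<close> by blast
  have upper: "\<forall>x\<in>Poly_Mapping.keys w. x \<le> h"
    unfolding exchange_equiv_bounds(2)[OF w, symmetric] keys_p using assms(4) \<open>l \<le> h\<close> by blast
  have least_upper: "h \<le> z" if "\<forall>x\<in>Poly_Mapping.keys w. x \<le> z" for z
    using that unfolding exchange_equiv_bounds(2)[OF w, symmetric] keys_p by blast
  have "l \<in> Poly_Mapping.keys w"
  proof (rule ccontr)
    assume nl: "l \<notin> Poly_Mapping.keys w"
    have "l \<in> Poly_Mapping.keys ?p" by simp
    then have "?p \<noteq> w" using nl by metis
    then have "degrevlex r w ?p" by (rule min[rule_format, OF exchange_equiv.refl])
    moreover have "total_degree ?p = total_degree w" using deg by simp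
    ultimately have "\<exists>x. expo ?p x < expo w x \<and> (\<forall>y. (y, x) \<in> r \<longrightarrow> expo w y = expo ?p y)"
      unfolding degrevlex_def by (metis less_irrefl)
    then obtain x where x: "expo ?p x < expo w x"
      and eq: "\<forall>y. (y, x) \<in> r \<longrightarrow> expo w y = expo ?p y"
      by (elim exE conjE)
    have "x \<in> Poly_Mapping.keys w" unfolding in_keys_iff using x by linarith
    then have "l \<le> x" "l \<noteq> x" using lower nl by auto
    then have "(l, x) \<in> r" by (intro extends_rank_less[OF r]) (simp add: less_le)
    then have "expo w l = expo ?p l" by (rule mp[OF spec[OF eq]])
    then show False using nl by (simp add: in_keys_iff lookup_add expo_X)
  qed
  then obtain w' where w': "w = X l + w'" by (rule key_factor)
  then have "total_degree w' = 2" using deg by simp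
  then obtain x y where xy: "w' = X x + X y" by (rule total_degree_2)
  have w_eq: "w = X l + X x + X y" by (simp add: w' xy add.assoc)
  have comparable: "x \<le> y \<or> y \<le> x"
    using chain by (simp add: chain_monom_def w_eq)
  define c where "c = inf x y"
  have "sup x y = h"
  proof (rule antisym)
    show "sup x y \<le> h" using upper by (simp add: w_eq)
    have "l \<le> x" using lower by (simp add: w_eq)
    then show "h \<le> sup x y" by (intro least_upper) (auto simp: w_eq intro: le_supI1)
  qed
  have w_eq': "w = X l + X c + X h"
    using comparable
  proof
    assume "x \<le> y"
    then have "c = x" "h = y"
      using \<open>sup x y = h\<close> by (simp_all add: c_def inf.absorb1 sup.absorb2)
    then show ?thesis by (simp add: w_eq)
  next
    assume "y \<le> x"
    then have "c = y" "h = x"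
      using \<open>sup x y = h\<close> by (simp_all add: c_def inf.absorb2 sup.absorb1)
    then show ?thesis by (simp add: w_eq ac_simps)
  qed
  have "weight lattice_rank ?p = weight lattice_rank w"
    using w by (rule exchange_equiv_weight) (rule rank_modular_law[OF mod])
  then have rank: "lattice_rank c = lattice_rank a" by (simp add: w_eq')
  show thesis
    by (rule that[OF w[unfolded w_eq'] rank min[unfolded w_eq']])
qed

text \<open>The witness is \<open>l c\<^sup>2 h\<close>, where \<open>l c h\<close> is the least monomial of the class of \<open>l a h\<close>: it lies in
  the initial ideal, but a squarefree monomial dividing it divides \<open>l c h\<close> too.\<close>

lemma non_distributive_imp_not_squarefree:
  fixes r :: "'l::{finite,lattice} rel"
  assumes mod: "modular_lattice TYPE('l)" and ndist: "\<not> distributive_lattice TYPE('l)"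
    and r: "extends_rank r"
  shows "\<not> has_squarefree_groebner_basis (degrevlex r)
    (lattice_ideal :: ('l, 'k::comm_ring_1) mpoly set)"
proof
  let ?I = "lattice_ideal :: ('l, 'k) mpoly set"
  let ?in = "initial_monomial (degrevlex r) :: ('l, 'k) mpoly \<Rightarrow> _"
  assume "has_squarefree_groebner_basis (degrevlex r) ?I"
  then obtain G where G: "G \<subseteq> ?I" "0 \<notin> G"
    and gen: "ideal_generated_by {monomial (?in g) | g. g \<in> G} = initial_ideal (degrevlex r) ?I"
    and sqfree: "\<And>g. g \<in> G \<Longrightarrow> squarefree_monom (?in g)"
    unfolding has_squarefree_groebner_basis_def is_groebner_basis_def by blast
  have lin: "strict_linear_order r" using r by (simp add: extends_rank_def)
  obtain l a b h :: 'l where "a \<noteq> b" and le: "l \<le> a" "a \<le> h" "l \<le> b" "b \<le> h"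
    and ab: "exchange_equiv (X l + X a + X h) (X l + X b + X h)"
    using non_distributive_equivalent_triples[OF mod ndist] by metis
  obtain c where c: "exchange_equiv (X l + X a + X h) (X l + X c + X h)"
    and rank_c: "lattice_rank c = lattice_rank a"
    and min: "\<forall>n. exchange_equiv (X l + X a + X h) n \<longrightarrow> n \<noteq> X l + X c + X h \<longrightarrow>
       degrevlex r (X l + X c + X h) n"
    by (rule least_in_class_of_triple[OF mod r le(1,2)])
  let ?w = "X l + X c + X h"
  have "weight lattice_rank (X l + X a + X h) = weight lattice_rank (X l + X b + X h)"
    using ab by (rule exchange_equiv_weight) (rule rank_modular_law[OF mod])
  then have "lattice_rank b = lattice_rank a" by simp
  \<comment> \<open>Comparable elements of equal rank are equal, and \<open>c\<close> cannot be both \<open>a\<close> and \<open>b\<close>.\<close>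
  then have "\<not> c \<le> a \<or> \<not> c \<le> b"
    using rank_c \<open>a \<noteq> b\<close> eq_if_le_if_rank_eq[of c a] eq_if_le_if_rank_eq[of c b] by auto
  then obtain d where d: "exchange_equiv ?w (X l + X d + X h)" "\<not> c \<le> d"
    using ab c exchange_equiv_sym exchange_equiv_trans by blast
  let ?e = "X l + X h + X c + X c" and ?n = "X l + X h + X (inf c d) + X (sup c d)"
  have "exchange_equiv ?e (X l + X h + X c + X d)"
    using exchange_equiv_add[OF d(1), of "X c"] by (simp add: ac_simps)
  then have "exchange_equiv ?e ?n" by (rule exchange_equiv.straighten)
  moreover have "degrevlex r ?n ?e"
  proof -
    have "inf c d < c" using d(2) by (metis inf_le1 inf_le2 less_le)
    moreover from this have "inf c d < sup c d" by (meson less_le_trans sup_ge1)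
    ultimately show ?thesis
      by (intro degrevlex_smaller_variable[OF lin]) (simp_all add: extends_rank_less[OF r])
  qed
  ultimately have "monomial ?e \<in> initial_ideal (degrevlex r) ?I"
    by (rule monomial_in_initial_ideal[OF lin])
  moreover have "{monomial (?in g) | g. g \<in> G} =
      (monomial ` ?in ` G :: ('l, 'k) mpoly set)" by blast
  ultimately have "monomial ?e \<in> ideal_generated_by (monomial ` ?in ` G :: ('l, 'k) mpoly set)"
    using gen by simp
  then obtain g t where g: "g \<in> G" and e: "?e = ?in g + t"
    using monomial_in_monomial_ideal[of ?e "?in ` G"] by blast
  have "expo (?in g) x \<le> expo ?w x" for x
  proof -
    have "expo (?in g) x \<le> expo ?e x" by (simp only: e lookup_add le_add1)
    moreover have "expo (?in g) x \<le> 1" using sqfree[OF g] by (simp add: squarefree_monom_def)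
    ultimately show ?thesis by (auto simp: lookup_add expo_X split: if_splits)
  qed
  then have "?w = ?in g + (?w - ?in g)"
    by (intro poly_mapping_eqI) (simp only: lookup_add lookup_minus le_add_diff_inverse)
  then obtain q where w: "?w = ?in g + q" by blast
  have "g \<in> ?I" "g \<noteq> 0" using g G by auto
  moreover have "?in g \<in> {n. exchange_equiv (?in g) n}" by (simp add: exchange_equiv.refl)
  ultimately obtain n where n: "exchange_equiv (?in g) n" "degrevlex r n (?in g)"
    using initial_monomial_not_least[OF lin _ _ exchange_closed_class] by blast
  \<comment> \<open>The multiple \<open>?w\<close> of \<open>?in g\<close> inherits a smaller equivalent monomial.\<close>
  have "exchange_equiv ?w (n + q)" unfolding w by (rule exchange_equiv_add[OF n(1)])
  with c have "exchange_equiv (X l + X a + X h) (n + q)" by (rule exchange_equiv_trans)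
  moreover have less: "degrevlex r (n + q) ?w" unfolding w by (rule degrevlex_add[OF n(2)])
  moreover have "n + q \<noteq> ?w" using less degrevlex_irrefl by metis
  ultimately have "degrevlex r ?w (n + q)" using min by blast
  then show False using degrevlex_trans[OF lin less] degrevlex_irrefl by blast
qed

theorem theorem1p1:
  assumes "modular_lattice TYPE('l::{finite,lattice})"
  shows "distributive_lattice TYPE('l) \<longleftrightarrow>
    (\<forall>ord :: 'l monom_order. rank_revlex_order ord \<longrightarrow>
       has_squarefree_groebner_basis ord (lattice_ideal :: ('l, 'k::field) mpoly set))"
proof -
  have rank_revlex: "rank_revlex_order ord \<longleftrightarrow> (\<exists>r. extends_rank r \<and> ord = degrevlex r)"
    for ord :: "'l monom_order"
    unfolding rank_revlex_order_def extends_rank_def by blast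
  show ?thesis
  proof
    assume dist: "distributive_lattice TYPE('l)"
    show "\<forall>ord :: 'l monom_order. rank_revlex_order ord \<longrightarrow>
       has_squarefree_groebner_basis ord (lattice_ideal :: ('l, 'k) mpoly set)"
      using distributive_imp_squarefree[OF dist] by (auto simp: rank_revlex)
  next
    assume sqfree: "\<forall>ord :: 'l monom_order. rank_revlex_order ord \<longrightarrow>
       has_squarefree_groebner_basis ord (lattice_ideal :: ('l, 'k) mpoly set)"
    obtain r :: "'l rel" where r: "extends_rank r" using extends_rank_exists by blast
    then have "rank_revlex_order (degrevlex r)" by (auto simp: rank_revlex)
    with sqfree have "has_squarefree_groebner_basis (degrevlex r)
        (lattice_ideal :: ('l, 'k) mpoly set)" by simp
    then show "distributive_lattice TYPE('l)"
      using non_distributive_imp_not_squarefree[OF assms _ r, where 'k = 'k] by blast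
  qed
qed

end
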